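(* Let $G$ be a finite loopless multigraph and $q\in V(G)$. If $c$ is a superstable configuration with respect to $q$, then there exists a burn list $v_1,v_2,\dots,v_n,q$ for $c$ with respect to $q$ that includes every vertex of $G$.
   Context: A finite loopless multigraph $G$ has a finite nonempty vertex set $V=V(G)$ and a finite multiset $E(G)$ of unordered pairs $\{v,w\}$ of vertices with $v\neq w$. A configuration with respect to $q$ is a function $c:V\setminus\{q\}\to\mathbb{Z}_{\ge 0}$, thought of as a number of chips at each vertex other than $q$. Set-firing a set $S\subseteq V\setminus\{q\}$ sends one chip along each edge from $S$ to $V\setminus S$ (chips sent to $q$ are discarded). The configuration $c$ is superstable if for every nonempty $S\subseteq V\setminus\{q\}$, set-firing $S$ makes the value at some vertex of $S$ negative, i.e. there is $v\in S$ such that $c(v)$ is less than the number of edges (with multiplicity) from $v$ to $V\setminus S$. A burn list for a configuration $c$ with respect to $q$ is a list $v_1,v_2,\dots,v_n,q$ of distinct vertices of $G$ ($n\ge 0$) such that, for each $i\in\{1,\dots,n\}$, the number of edges (with multiplicity) from $v_i$ to $\{v_{i+1},\dots,v_n,q\}$ is greater than $c(v_i)$. *)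

theory Defs
  imports "HOL-Library.Multiset"
begin

definition loopless_multigraph :: "'a set \<Rightarrow> 'a set multiset \<Rightarrow> bool" where
  "loopless_multigraph V E \<longleftrightarrow>
     finite V \<and> V \<noteq> {} \<and>
     (\<forall>e\<in>#E. \<exists>v w. v \<in> V \<and> w \<in> V \<and> v \<noteq> w \<and> e = {v, w})"

definition edges_to :: "'a set multiset \<Rightarrow> 'a \<Rightarrow> 'a set \<Rightarrow> nat" where
  "edges_to E v A = size {#e \<in># E. \<exists>w\<in>A. e = {v, w}#}"

text \<open>
  A configuration with respect to \<open>q\<close> is a total function \<open>c :: 'a \<Rightarrow> nat\<close> of which only the
  values on \<open>V - {q}\<close> are ever used. Firing may make values negative, so the result is
  integer-valued; its value at \<open>q\<close>, where chips are discarded, is meaningless.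
\<close>

definition set_fire :: "'a set \<Rightarrow> 'a set multiset \<Rightarrow> 'a set \<Rightarrow> ('a \<Rightarrow> nat) \<Rightarrow> 'a \<Rightarrow> int" where
  "set_fire V E S c v =
     (if v \<in> S then int (c v) - int (edges_to E v (V - S))
      else int (c v) + int (edges_to E v S))"

definition superstable :: "'a set \<Rightarrow> 'a set multiset \<Rightarrow> 'a \<Rightarrow> ('a \<Rightarrow> nat) \<Rightarrow> bool" where
  "superstable V E q c \<longleftrightarrow>
     (\<forall>S. S \<noteq> {} \<and> S \<subseteq> V - {q} \<longrightarrow> (\<exists>v\<in>S. set_fire V E S c v < 0))"

lemma superstable_iff:
  "superstable V E q c \<longleftrightarrow>
     (\<forall>S. S \<noteq> {} \<and> S \<subseteq> V - {q} \<longrightarrow> (\<exists>v\<in>S. c v < edges_to E v (V - S)))"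
  unfolding superstable_def set_fire_def by auto

text \<open>The list \<open>vs\<close> includes the final \<open>q\<close>; the burning condition is not imposed at \<open>q\<close>.\<close>

definition burn_list :: "'a set \<Rightarrow> 'a set multiset \<Rightarrow> 'a \<Rightarrow> ('a \<Rightarrow> nat) \<Rightarrow> 'a list \<Rightarrow> bool" where
  "burn_list V E q c vs \<longleftrightarrow>
     vs \<noteq> [] \<and> last vs = q \<and> distinct vs \<and> set vs \<subseteq> V \<and>
     (\<forall>i < length vs - 1. edges_to E (vs ! i) (set (drop (Suc i) vs)) > c (vs ! i))"

end

theory Submission
  imports Defs
begin

text \<open>
  This is Dhar's burning algorithm, run backwards along the list: the fire starts at \<open>q\<close>, and a
  vertex catches fire, and is put at the front of the list, once more edges join it to burnt
  vertices than it has chips. Suppose that some vertices are still unburnt, and let \<open>S\<close> be the set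
  of all of them. The complement of \<open>S\<close> is exactly the burnt set, so a vertex that goes negative
  when \<open>S\<close> fires is one that the fire can reach next. Superstability says that such a vertex
  always exists, so the fire stops only when everything has burnt.
\<close>

lemma burn_list_singleton:
  assumes "q \<in> V"
  shows "burn_list V E q c [q]"
  using assms by (simp add: burn_list_def)

text \<open>
  Burn lists grow at the front because the condition at a vertex mentions only the entries after
  it, so the conditions already established are unaffected.
\<close>

lemma burn_list_Cons:
  assumes vs: "burn_list V E q c vs"
    and v: "v \<in> V" "v \<notin> set vs" "c v < edges_to E v (set vs)"
  shows "burn_list V E q c (v # vs)"
proof -
  have burning: "\<forall>i < length vs - 1. edges_to E (vs ! i) (set (drop (Suc i) vs)) > c (vs ! i)"
    and "vs \<noteq> []"
    using vs by (simp_all add: burn_list_def)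
  have "c ((v # vs) ! i) < edges_to E ((v # vs) ! i) (set (drop (Suc i) (v # vs)))"
    if "i < length (v # vs) - 1" for i
  proof (cases i)
    case 0
    then show ?thesis using v(3) by simp
  next
    case (Suc j)
    then have "j < length vs - 1" using that by simp
    then show ?thesis using burning Suc by simp
  qed
  then show ?thesis
    using vs v(1,2) unfolding burn_list_def by simp
qed

lemma superstable_burn_list_extend:
  assumes c: "superstable V E q c"
    and vs: "burn_list V E q c vs"
    and "\<not> V \<subseteq> set vs"
  obtains v where "v \<notin> set vs" "burn_list V E q c (v # vs)"
proof -
  let ?S = "V - set vs"
  have "q \<in> set vs" and "set vs \<subseteq> V"
    using vs last_in_set by (auto simp: burn_list_def)
  then have S: "?S \<noteq> {}" "?S \<subseteq> V - {q}" and burnt: "V - ?S = set vs"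
    using assms(3) by auto
  have "\<exists>v\<in>?S. c v < edges_to E v (V - ?S)"
    using c[unfolded superstable_iff, rule_format, OF conjI, OF S] .
  then obtain v where "v \<in> V" "v \<notin> set vs" "c v < edges_to E v (set vs)"
    unfolding burnt by auto
  then show thesis
    using that burn_list_Cons[OF vs] by simp
qed

lemma superstable_burn_list_covers:
  assumes "finite V" and "superstable V E q c" and "burn_list V E q c vs"
  shows "\<exists>ws. burn_list V E q c ws \<and> V \<subseteq> set ws"
  using assms(3)
proof (induction "card (V - set vs)" arbitrary: vs rule: less_induct)
  case less
  show ?case
  proof (cases "V \<subseteq> set vs")
    case True
    then show ?thesis using less.prems by blast
  next
    case False
    then obtain v where v: "v \<notin> set vs" "burn_list V E q c (v # vs)"
      by (rule superstable_burn_list_extend[OF assms(2) less.prems])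
    then have "V - set (v # vs) \<subset> V - set vs"
      by (auto simp: burn_list_def)
    then have "card (V - set (v # vs)) < card (V - set vs)"
      using \<open>finite V\<close> by (simp add: psubset_card_mono)
    then show ?thesis using less.hyps v(2) by blast
  qed
qed

theorem lemma5p2:
  fixes V :: "'a set" and E :: "'a set multiset" and q :: 'a and c :: "'a \<Rightarrow> nat"
  assumes "loopless_multigraph V E"
    and "q \<in> V"
    and "superstable V E q c"
  shows "\<exists>vs. burn_list V E q c vs \<and> V \<subseteq> set vs"
proof -
  have "finite V"
    using assms(1) by (simp add: loopless_multigraph_def)
  then show ?thesis
    by (rule superstable_burn_list_covers[OF _ assms(3) burn_list_singleton[OF assms(2)]])
qed

end
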